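(* Let $n\ge 1$ be an integer. Suppose that $2n-1$ players seek to rent two rooms, one in each of two buildings containing $n$ rooms each, and that each player prefers free rooms if available, has closed preference sets, and in any division of the rents finds a collection of two rooms, one in each building, acceptable. Then there exist a division $x$ of the rents, a subset $N$ of $n$ players, and for each $e\in N$ a room selection $(s^e_1,s^e_2)\in[n]^2$ acceptable to $e$ in $x$, such that for distinct $e,e'\in N$ we have $s^e_1\ne s^{e'}_1$ and $s^e_2\neq s^{e'}_2$; that is, the $n$ players each get their preferred two rooms.
   Context: $[n]=\{1,\dots,n\}$ and $\Delta_{n-1}=\{y\in\mathbb{R}^n_{\ge 0}:\sum_{i} y_i=1\}$. A division of the rents is a point $x=(x_1,x_2)\in\Delta_{n-1}\times\Delta_{n-1}$, where the $i$-th coordinate of $x_j$ is the fraction of the total rent of building $j$ that is assigned to room $i$ of building $j$; a room is free if its rent is $0$. A room selection is a pair $s=(s_1,s_2)\in[n]^2$ (room $s_j$ in building $j$). Each player $e$ has preferences given by a set $C^e_s\subseteq\Delta_{n-1}\times\Delta_{n-1}$ for each $s\in[n]^2$: $s$ is acceptable to $e$ in $x$ iff $x\in C^e_s$; several selections may be acceptable in the same division. Closed preference sets means that every $C^e_s$ is closed. "Prefers free rooms if available" means: if $s$ is acceptable to $e$ in $x$ and building $j$ has at least one free room in $x$, then $s_j$ is a free room of building $j$. Players are indifferent between several free rooms in the same building: if $s$ is acceptable to $e$ in $x$ and $s_j$ is a free room of building $j$, then replacing $s_j$ by any other free room of building $j$ again gives a selection acceptable to $e$ in $x$. *)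

theory Defs
  imports "HOL-Analysis.Analysis"
begin

text \<open>
  The rooms of each of the two buildings are indexed by the same finite type \<open>'r\<close>, which plays the
  role of $[n]$ with \<open>n = CARD('r)\<close>; since types are nonempty, \<open>n \<ge> 1\<close>.
  The first component of every pair refers to building 1, the second to building 2.
\<close>

type_synonym 'r division = "(real ^ 'r) \<times> (real ^ 'r)"

type_synonym 'r selection = "'r \<times> 'r"

text \<open>A player's preferences: \<open>C s\<close> is the set of divisions in which \<open>s\<close> is acceptable.\<close>

type_synonym 'r preferences = "'r selection \<Rightarrow> 'r division set"

definition rent_simplex :: "(real ^ 'r::finite) set" where
  "rent_simplex = {y. (\<forall>i. 0 \<le> y $ i) \<and> (\<Sum>i\<in>UNIV. y $ i) = 1}"

definition divisions :: "'r::finite division set" where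
  "divisions = rent_simplex \<times> rent_simplex"

definition is_free :: "real ^ 'r::finite \<Rightarrow> 'r \<Rightarrow> bool" where
  "is_free y i \<longleftrightarrow> y $ i = 0"

text \<open>
  Closedness below is in the ambient space; as \<open>divisions\<close> is closed, this agrees with closedness
  relative to \<open>divisions\<close>.
\<close>

definition closed_preferences :: "'r::finite preferences \<Rightarrow> bool" where
  "closed_preferences C \<longleftrightarrow> (\<forall>s. closed (C s))"

definition prefers_free_rooms :: "'r::finite preferences \<Rightarrow> bool" where
  "prefers_free_rooms C \<longleftrightarrow>
     (\<forall>s. \<forall>x \<in> C s.
        ((\<exists>i. is_free (fst x) i) \<longrightarrow> is_free (fst x) (fst s)) \<and>
        ((\<exists>i. is_free (snd x) i) \<longrightarrow> is_free (snd x) (snd s)))"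

definition indifferent_between_free_rooms :: "'r::finite preferences \<Rightarrow> bool" where
  "indifferent_between_free_rooms C \<longleftrightarrow>
     (\<forall>s. \<forall>x \<in> C s. \<forall>i.
        (is_free (fst x) (fst s) \<and> is_free (fst x) i \<longrightarrow> x \<in> C (i, snd s)) \<and>
        (is_free (snd x) (snd s) \<and> is_free (snd x) i \<longrightarrow> x \<in> C (fst s, i)))"

definition always_finds_acceptable :: "'r::finite preferences \<Rightarrow> bool" where
  "always_finds_acceptable C \<longleftrightarrow> (\<forall>x \<in> divisions. \<exists>s. x \<in> C s)"

end

theory Submission
  imports Defs
begin

text \<open>
  Let \<open>n\<close> be the number of rooms per building. Replace a selection by the pair of unit vectors
  of its two rooms, so that a convex combination of selections records the demand for every room.
  The aim is a division \<open>x\<close> and one selection per player, acceptable in \<open>x\<close>, such that some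
  convex combination of these selections demands every room equally, with weight \<open>1 / n\<close>. The
  selections are then the edges of a bipartite graph between the two buildings carrying a
  fractional perfect matching, so by Hall's theorem the graph has a perfect matching. Different
  edges of this matching come from different players, and these \<open>n\<close> players are the set sought.

  Such an \<open>x\<close> is found as an equilibrium. For a continuous demand function \<open>F\<close> on divisions, raise
  the rent of every room whose demand exceeds \<open>1 / n\<close>, and renormalise. By Brouwer's theorem this
  adjustment has a fixed point. At a fixed point with an overdemanded room, the overdemanded rooms
  are exactly those with positive rent; some room is not overdemanded, hence free; and then players
  who prefer free rooms demand free rooms only, so no room of positive rent is overdemanded. Hence
  demand is uniform (\<open>price_step_fixed_imp_barycentre\<close>).

  What makes \<open>2 n - 1\<close> players enough is that demand is aggregated with weights that depend on the
  division. The divisions form a set of dimension \<open>2 n - 2\<close>. Lay a fine integer lattice over it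
  and assign each lattice point to a player, by its coordinate sum modulo \<open>2 n - 1\<close>. The vertices
  of a simplex of Kuhn's triangulation then belong to distinct players, so interpolating from the
  vertices combines at most one selection of each player
  (\<open>coloured_approximate_fixed_point\<close>). As the mesh tends to \<open>0\<close>, compactness and closedness of the
  preferences give exact acceptability at one division (\<open>coloured_fixed_point\<close>). The preference
  for free rooms enters only at that limit division, so the interpolation near the boundary needs
  no care.
\<close>

section \<open>A coloured partition of unity\<close>

text \<open>
  Positive exactly on the open star of the origin in Kuhn's triangulation of the integer lattice.
  Only the sign of the bump and its continuity matter, so a product of tents replaces the
  piecewise linear hat function, and normalising is left to the partition of unity.
\<close>

definition kuhn_hat :: "'i set \<Rightarrow> ('i \<Rightarrow> real) \<Rightarrow> real" where
  "kuhn_hat I y = (\<Prod>i\<in>I. max 0 (1 - \<bar>y i\<bar>)) * (\<Prod>i\<in>I. \<Prod>j\<in>I. max 0 (1 - \<bar>y i - y j\<bar>))"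

lemma kuhn_hat_nonneg: "0 \<le> kuhn_hat I y"
  unfolding kuhn_hat_def by (intro mult_nonneg_nonneg prod_nonneg) auto

lemma kuhn_hat_pos_iff:
  assumes "finite I"
  shows "0 < kuhn_hat I y \<longleftrightarrow> (\<forall>i\<in>I. \<bar>y i\<bar> < 1) \<and> (\<forall>i\<in>I. \<forall>j\<in>I. \<bar>y i - y j\<bar> < 1)"
proof -
  have bump: "max 0 (1 - a) = 0 \<longleftrightarrow> \<not> a < 1" for a :: real
    by auto
  have "kuhn_hat I y \<noteq> 0 \<longleftrightarrow> (\<forall>i\<in>I. \<bar>y i\<bar> < 1) \<and> (\<forall>i\<in>I. \<forall>j\<in>I. \<bar>y i - y j\<bar> < 1)"
    using assms unfolding kuhn_hat_def by (simp add: bump)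
  then show ?thesis
    using kuhn_hat_nonneg[of I y] by auto
qed

lemma kuhn_hat_cong: "(\<And>i. i \<in> I \<Longrightarrow> y i = z i) \<Longrightarrow> kuhn_hat I y = kuhn_hat I z"
  unfolding kuhn_hat_def by (simp cong: prod.cong)

lemma kuhn_hat_floor_pos:
  assumes "finite I"
  shows "0 < kuhn_hat I (\<lambda>i. t i - of_int \<lfloor>t i\<rfloor>)"
proof -
  have "0 \<le> t i - of_int \<lfloor>t i\<rfloor>" "t i - of_int \<lfloor>t i\<rfloor> < 1" for i
    by linarith+
  then show ?thesis
    unfolding kuhn_hat_pos_iff[OF assms] by (smt (verit))
qed

text \<open>
  Two lattice points whose bumps overlap are vertices of a common simplex: their difference has all
  entries in \<open>{0, 1}\<close> or all entries in \<open>{0, -1}\<close>. Its sum is thus at most \<open>card I\<close> in absolute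
  value, and is divisible by \<open>card I + 1\<close> only if it vanishes.
\<close>

lemma kuhn_hat_same_colour:
  fixes v w :: "'i \<Rightarrow> int" and t :: "'i \<Rightarrow> real"
  assumes fin: "finite I"
    and v: "0 < kuhn_hat I (\<lambda>i. t i - v i)" and w: "0 < kuhn_hat I (\<lambda>i. t i - w i)"
    and colour: "(\<Sum>i\<in>I. v i) mod (int (card I) + 1) = (\<Sum>i\<in>I. w i) mod (int (card I) + 1)"
    and i: "i \<in> I"
  shows "v i = w i"
proof -
  define u where "u i = v i - w i" for i
  have close: "\<bar>u j\<bar> \<le> 1" "\<bar>u j - u k\<bar> \<le> 1" if "j \<in> I" "k \<in> I" for j k
  proof -
    have "\<bar>t j - v j\<bar> < 1" "\<bar>t j - w j\<bar> < 1"
      "\<bar>(t j - v j) - (t k - v k)\<bar> < 1" "\<bar>(t j - w j) - (t k - w k)\<bar> < 1"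
      using v w that unfolding kuhn_hat_pos_iff[OF fin] by blast+
    then have "\<bar>of_int (u j)\<bar> < (2::real)" "\<bar>of_int (u j - u k)\<bar> < (2::real)"
      unfolding u_def by auto
    then show "\<bar>u j\<bar> \<le> 1" "\<bar>u j - u k\<bar> \<le> 1"
      by linarith+
  qed
  have dvd: "(int (card I) + 1) dvd (\<Sum>i\<in>I. u i)"
    using colour unfolding u_def sum_subtractf by (simp add: mod_eq_dvd_iff)
  have "\<bar>\<Sum>i\<in>I. u i\<bar> \<le> (\<Sum>i\<in>I. \<bar>u i\<bar>)"
    by (rule sum_abs)
  also have "\<dots> \<le> int (card I)"
    using sum_bounded_above[of I "\<lambda>i. \<bar>u i\<bar>" 1] close(1) by simp
  finally have "\<bar>\<Sum>i\<in>I. u i\<bar> \<le> int (card I)" .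
  then have sum0: "(\<Sum>i\<in>I. u i) = 0"
    using dvd zdvd_not_zless[of "\<bar>\<Sum>i\<in>I. u i\<bar>" "int (card I) + 1"] by auto
  \<comment> \<open>The entries of \<open>u\<close> cannot have opposite signs, so a vanishing sum forces each to vanish.\<close>
  have "(\<forall>j\<in>I. 0 \<le> u j) \<or> (\<forall>j\<in>I. u j \<le> 0)"
    using close by (smt (verit))
  then have "u i = 0"
  proof
    assume "\<forall>j\<in>I. 0 \<le> u j"
    then show ?thesis using sum_nonneg_eq_0_iff[OF fin, of u] sum0 i by auto
  next
    assume "\<forall>j\<in>I. u j \<le> 0"
    then show ?thesis
      using sum_nonneg_eq_0_iff[OF fin, of "\<lambda>j. - u j"] sum0 i by (auto simp: sum_negf)
  qed
  then show ?thesis by (simp add: u_def)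
qed

text \<open>
  The functions \<open>t i\<close> place \<open>X\<close> in a coordinate space, which is scaled so that the stars of the
  lattice points have diameter \<open>\<epsilon>\<close> in every coordinate. Only lattice points whose bump meets \<open>X\<close>
  are kept; since a point of \<open>X\<close> in the star can serve as a sample, the lattice points themselves
  need not lie in \<open>X\<close>.
\<close>

lemma coloured_partition_of_unity:
  fixes X :: "'a::metric_space set" and t :: "'i \<Rightarrow> 'a \<Rightarrow> real"
  assumes X: "compact X" and fin: "finite I"
    and t: "\<forall>i\<in>I. continuous_on X (t i)" and "0 < \<epsilon>"
  obtains V :: "('i \<Rightarrow> int) set" and \<phi> colour where
    "finite V"
    "\<And>v. continuous_on X (\<phi> v)" "\<And>v x. x \<in> X \<Longrightarrow> 0 \<le> \<phi> v x"
    "\<And>x. x \<in> X \<Longrightarrow> (\<Sum>v\<in>V. \<phi> v x) = (1::real)"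
    "\<And>v. v \<in> V \<Longrightarrow> \<exists>x\<in>X. 0 < \<phi> v x"
    "\<And>v x y i. 0 < \<phi> v x \<Longrightarrow> 0 < \<phi> v y \<Longrightarrow> x \<in> X \<Longrightarrow> y \<in> X \<Longrightarrow> i \<in> I
      \<Longrightarrow> \<bar>t i x - t i y\<bar> < \<epsilon>"
    "\<And>v. colour v < card I + 1"
    "\<And>v w x. v \<in> V \<Longrightarrow> w \<in> V \<Longrightarrow> x \<in> X \<Longrightarrow> 0 < \<phi> v x \<Longrightarrow> 0 < \<phi> w x
      \<Longrightarrow> colour v = colour w \<Longrightarrow> v = w"
proof -
  define h where "h v x = kuhn_hat I (\<lambda>i. 2 / \<epsilon> * t i x - of_int (v i))" for v x
  define V where "V = {v \<in> I \<rightarrow>\<^sub>E UNIV. \<exists>x\<in>X. 0 < h v x}"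
  define \<phi> where "\<phi> v x = h v x / (\<Sum>w\<in>V. h w x)" for v x
  define colour where "colour v = nat ((\<Sum>i\<in>I. v i) mod (int (card I) + 1))" for v :: "'i \<Rightarrow> int"
  have hpos: "\<bar>2 / \<epsilon> * t i x - of_int (v i)\<bar> < 1" if "0 < h v x" "i \<in> I" for v x i
    using that unfolding h_def kuhn_hat_pos_iff[OF fin] by blast
  have "\<exists>B. \<forall>x\<in>X. \<bar>2 / \<epsilon> * t i x\<bar> \<le> of_int B" if "i \<in> I" for i
  proof -
    have "bounded ((\<lambda>x. 2 / \<epsilon> * t i x) ` X)"
      by (intro compact_imp_bounded compact_continuous_image continuous_intros X t[rule_format] that)
    then obtain b where "\<forall>x\<in>X. \<bar>2 / \<epsilon> * t i x\<bar> \<le> b"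
      by (auto simp: bounded_iff)
    then have "\<forall>x\<in>X. \<bar>2 / \<epsilon> * t i x\<bar> \<le> of_int \<lceil>b\<rceil>"
      by (meson le_of_int_ceiling order_trans)
    then show ?thesis by blast
  qed
  then obtain B where B: "\<And>i x. i \<in> I \<Longrightarrow> x \<in> X \<Longrightarrow> \<bar>2 / \<epsilon> * t i x\<bar> \<le> of_int (B i)"
    by metis
  have "V \<subseteq> (\<Pi>\<^sub>E i\<in>I. {- B i - 1..B i + 1})"
  proof
    fix v assume "v \<in> V"
    then obtain x where x: "x \<in> X" "0 < h v x" and v: "v \<in> I \<rightarrow>\<^sub>E UNIV"
      by (auto simp: V_def)
    have "v i \<in> {- B i - 1..B i + 1}" if "i \<in> I" for i
      using hpos[OF x(2) that] B[OF that x(1)] by (simp only: atLeastAtMost_iff) linarith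
    with v show "v \<in> (\<Pi>\<^sub>E i\<in>I. {- B i - 1..B i + 1})"
      by (auto simp: PiE_iff)
  qed
  then have finV: "finite V"
    by (rule finite_subset) (intro finite_PiE fin, auto)
  have h0: "0 \<le> h v x" for v x
    by (simp add: h_def kuhn_hat_nonneg)
  have sum_pos: "0 < (\<Sum>w\<in>V. h w x)" if x: "x \<in> X" for x
  proof -
    define v where "v = (\<lambda>i\<in>I. \<lfloor>2 / \<epsilon> * t i x\<rfloor>)"
    have "h v x = kuhn_hat I (\<lambda>i. 2 / \<epsilon> * t i x - of_int \<lfloor>2 / \<epsilon> * t i x\<rfloor>)"
      unfolding h_def by (rule kuhn_hat_cong) (simp add: v_def)
    then have pos: "0 < h v x"
      using kuhn_hat_floor_pos[OF fin, of "\<lambda>i. 2 / \<epsilon> * t i x"] by simp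
    moreover have "v \<in> V"
      using x pos by (auto simp: V_def v_def)
    ultimately show ?thesis
      using finV h0 by (intro sum_pos2[of V v]) auto
  qed
  have \<phi>_pos: "0 < \<phi> v x \<longleftrightarrow> 0 < h v x" if "x \<in> X" for v x
    using sum_pos[OF that] by (simp add: \<phi>_def zero_less_divide_iff)
  have h_cont: "continuous_on X (h v)" for v
    unfolding h_def kuhn_hat_def by (intro continuous_intros t[rule_format]) auto
  show thesis
  proof (rule that[of V \<phi> colour])
    show "finite V" by (rule finV)
    show "continuous_on X (\<phi> v)" for v
      unfolding \<phi>_def using sum_pos by (intro continuous_intros h_cont) force
    show "0 \<le> \<phi> v x" if "x \<in> X" for v x
      using h0 sum_pos[OF that] by (simp add: \<phi>_def)
    show "(\<Sum>v\<in>V. \<phi> v x) = 1" if "x \<in> X" for x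
      using sum_pos[OF that] by (simp add: \<phi>_def flip: sum_divide_distrib)
    show "\<exists>x\<in>X. 0 < \<phi> v x" if "v \<in> V" for v
      using that \<phi>_pos by (auto simp: V_def)
    show "\<bar>t i x - t i y\<bar> < \<epsilon>"
      if "0 < \<phi> v x" "0 < \<phi> v y" "x \<in> X" "y \<in> X" "i \<in> I" for v x y i
    proof -
      have "0 < h v x" "0 < h v y"
        using that \<phi>_pos by blast+
      then have "\<bar>2 / \<epsilon> * t i x - 2 / \<epsilon> * t i y\<bar> < 2"
        using hpos[of v x i] hpos[of v y i] \<open>i \<in> I\<close> by linarith
      moreover have "\<bar>2 / \<epsilon> * t i x - 2 / \<epsilon> * t i y\<bar> = 2 / \<epsilon> * \<bar>t i x - t i y\<bar>"
        using \<open>0 < \<epsilon>\<close> unfolding right_diff_distrib[symmetric] abs_mult by simp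
      ultimately show ?thesis
        using \<open>0 < \<epsilon>\<close> by (simp add: field_simps)
    qed
    have colour: "int (colour v) = (\<Sum>i\<in>I. v i) mod (int (card I) + 1)" for v
      unfolding colour_def by (intro int_nat_eq[THEN trans] if_P pos_mod_sign) linarith
    show "colour v < card I + 1" for v
      using colour[of v] pos_mod_bound[of "int (card I) + 1" "\<Sum>i\<in>I. v i"] by linarith
    show "v = w"
      if "v \<in> V" "w \<in> V" "x \<in> X" "0 < \<phi> v x" "0 < \<phi> w x" "colour v = colour w" for v w x
    proof (rule PiE_ext)
      show "v \<in> I \<rightarrow>\<^sub>E UNIV" "w \<in> I \<rightarrow>\<^sub>E UNIV"
        using that by (auto simp: V_def)
      have eq: "(\<Sum>i\<in>I. v i) mod (int (card I) + 1) = (\<Sum>i\<in>I. w i) mod (int (card I) + 1)"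
        using colour[of v] colour[of w] that(6) by metis
      have pos: "0 < h v x" "0 < h w x"
        using that \<phi>_pos by auto
      show "v i = w i" if "i \<in> I" for i
        by (rule kuhn_hat_same_colour[OF fin pos[unfolded h_def] eq that])
    qed
  qed
qed

section \<open>A coloured fixed point theorem\<close>

text \<open>
  Each lattice point belongs to the player of its colour, who names a label valid at a sample point
  in the star. The interpolation \<open>F\<close> of these labels is continuous, so Brouwer's theorem applies to
  \<open>x \<mapsto> G (x, F x)\<close>. At the fixed point the active lattice points have distinct owners, which
  makes \<open>F x\<close> a combination of one label per player.
\<close>

lemma coloured_approximate_fixed_point:
  fixes X :: "'a::euclidean_space set" and t :: "'i \<Rightarrow> 'a \<Rightarrow> real"
    and C :: "'p \<Rightarrow> 's::finite \<Rightarrow> 'a set" and g :: "'s \<Rightarrow> 'b::euclidean_space"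
    and G :: "'a \<times> 'b \<Rightarrow> 'a"
  assumes X: "compact X" "convex X" "X \<noteq> {}"
    and I: "finite I" "\<forall>i\<in>I. continuous_on X (t i)"
    and P: "finite P" "card P = card I + 1"
    and cover: "\<forall>e\<in>P. \<forall>x\<in>X. \<exists>s. x \<in> C e s"
    and G: "continuous_on (X \<times> (convex hull range g)) G"
      "G ` (X \<times> (convex hull range g)) \<subseteq> X"
    and "0 < \<epsilon>"
  shows "\<exists>x\<in>X. \<exists>s. \<exists>b\<in>convex hull (g ` s ` P). G (x, b) = x \<and>
    (\<forall>e\<in>P. \<exists>y\<in>X \<inter> C e (s e). \<forall>i\<in>I. \<bar>t i x - t i y\<bar> < \<epsilon>)"
proof -
  obtain V :: "('i \<Rightarrow> int) set" and \<phi> colour where V: "finite V"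
    and \<phi>: "\<And>v. continuous_on X (\<phi> v)" "\<And>v x. x \<in> X \<Longrightarrow> 0 \<le> \<phi> v x"
      "\<And>x. x \<in> X \<Longrightarrow> (\<Sum>v\<in>V. \<phi> v x) = (1::real)"
    and ex: "\<And>v. v \<in> V \<Longrightarrow> \<exists>x\<in>X. 0 < \<phi> v x"
    and small: "\<And>v x y i. 0 < \<phi> v x \<Longrightarrow> 0 < \<phi> v y \<Longrightarrow> x \<in> X \<Longrightarrow> y \<in> X \<Longrightarrow> i \<in> I
      \<Longrightarrow> \<bar>t i x - t i y\<bar> < \<epsilon>"
    and colour: "\<And>v. colour v < card I + 1"
      "\<And>v w x. v \<in> V \<Longrightarrow> w \<in> V \<Longrightarrow> x \<in> X \<Longrightarrow> 0 < \<phi> v x \<Longrightarrow> 0 < \<phi> w x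
        \<Longrightarrow> colour v = colour w \<Longrightarrow> v = w"
    by (rule coloured_partition_of_unity[where t = t, OF X(1) I \<open>0 < \<epsilon>\<close>]) (rule that)
  obtain p where p: "bij_betw p {0..<card P} P"
    using ex_bij_betw_nat_finite[OF P(1)] by blast
  define owner where "owner v = p (colour v)" for v
  have owner: "owner v \<in> P" for v
    using bij_betwE[OF p] colour(1) P(2) by (simp add: owner_def)
  have owner_inj: "v = w"
    if "v \<in> V" "w \<in> V" "x \<in> X" "0 < \<phi> v x" "0 < \<phi> w x" "owner v = owner w" for v w x
  proof -
    have "colour v = colour w"
      using bij_betw_imp_inj_on[OF p] that(6) colour(1) P(2) by (simp add: owner_def inj_on_eq_iff)
    then show ?thesis using colour(2) that by blast
  qed
  have "\<exists>y l. v \<in> V \<longrightarrow> y \<in> X \<and> 0 < \<phi> v y \<and> y \<in> C (owner v) l" for v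
    using ex cover owner by meson
  then obtain y l where yl: "\<And>v. v \<in> V \<Longrightarrow> y v \<in> X \<and> 0 < \<phi> v (y v) \<and> y v \<in> C (owner v) (l v)"
    by metis
  define F where "F x = (\<Sum>v\<in>V. \<phi> v x *\<^sub>R g (l v))" for x
  have F_hull: "F x \<in> convex hull range g" if "x \<in> X" for x
    unfolding F_def using \<phi> that by (intro convex_sum V convex_convex_hull) (auto intro: hull_inc)
  have "continuous_on X (\<lambda>x. G (x, F x))"
  proof (rule continuous_on_compose2[OF G(1)])
    show "continuous_on X (\<lambda>x. (x, F x))"
      unfolding F_def by (intro continuous_intros \<phi>)
  qed (use F_hull in auto)
  moreover have "(\<lambda>x. G (x, F x)) \<in> X \<rightarrow> X"
    using G(2) F_hull by auto
  ultimately obtain x where x: "x \<in> X" "G (x, F x) = x"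
    by (rule brouwer[OF X])
  define active where "active v \<longleftrightarrow> v \<in> V \<and> 0 < \<phi> v x" for v
  \<comment> \<open>A player without active lattice point has weight \<open>0\<close> and may take any label valid at \<open>x\<close>.\<close>
  have "\<exists>s. (\<exists>v. active v \<and> owner v = e \<and> s = l v) \<or> (\<nexists>v. active v \<and> owner v = e) \<and> x \<in> C e s"
    if "e \<in> P" for e
    using cover that x(1) by blast
  then obtain s where s: "\<And>e. e \<in> P \<Longrightarrow> (\<exists>v. active v \<and> owner v = e \<and> s e = l v)
      \<or> (\<nexists>v. active v \<and> owner v = e) \<and> x \<in> C e (s e)"
    by metis
  have s_owner: "s (owner v) = l v" if "active v" for v
    using s[OF owner[of v]] owner_inj x(1) that unfolding active_def by metis
  have "F x = (\<Sum>v | active v. \<phi> v x *\<^sub>R g (l v))"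
    unfolding F_def active_def using \<phi>(2)[OF x(1)] V
    by (intro sum.mono_neutral_right) (auto simp: order_less_le)
  moreover have "\<dots> \<in> convex hull (g ` s ` P)"
  proof (intro convex_sum convex_convex_hull)
    show "finite {v. active v}"
      using V by (simp add: active_def)
    have "(\<Sum>v\<in>V. \<phi> v x) = (\<Sum>v | active v. \<phi> v x)"
      unfolding active_def using \<phi>(2)[OF x(1)] V
      by (intro sum.mono_neutral_right) (auto simp: order_less_le)
    then show "(\<Sum>v | active v. \<phi> v x) = 1"
      using \<phi>(3)[OF x(1)] by simp
    show "0 \<le> \<phi> v x" for v by (rule \<phi>(2)[OF x(1)])
    show "g (l v) \<in> convex hull (g ` s ` P)" if "v \<in> {v. active v}" for v
      using that s_owner[of v] owner[of v] by (intro hull_inc) force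
  qed
  ultimately have "F x \<in> convex hull (g ` s ` P)" by simp
  moreover have "\<exists>y\<in>X \<inter> C e (s e). \<forall>i\<in>I. \<bar>t i x - t i y\<bar> < \<epsilon>" if "e \<in> P" for e
    using s[OF that]
  proof
    assume "\<exists>v. active v \<and> owner v = e \<and> s e = l v"
    then obtain v where v: "v \<in> V" "0 < \<phi> v x" "owner v = e" "s e = l v"
      unfolding active_def by blast
    have y: "y v \<in> X" "0 < \<phi> v (y v)" "y v \<in> C e (s e)"
      using yl[OF v(1)] v(3,4) by simp_all
    have "\<forall>i\<in>I. \<bar>t i x - t i (y v)\<bar> < \<epsilon>"
      using small[OF v(2) y(2) x(1) y(1)] by blast
    with y show ?thesis by blast
  next
    assume "(\<nexists>v. active v \<and> owner v = e) \<and> x \<in> C e (s e)"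
    then show ?thesis
      using x(1) \<open>0 < \<epsilon>\<close> by (intro bexI[of _ x]) auto
  qed
  ultimately show ?thesis using x by blast
qed

text \<open>
  A colourful counterpart of Kakutani's theorem: the labels that a player accepts at \<open>x\<close> form a
  closed correspondence, and a single convex combination of one label per player, at weights not
  prescribed in advance, solves the fixed point equation. The limit is taken without sequences.
  For each of the finitely many assignments \<open>s\<close> of labels, the defect \<open>gap s\<close> is continuous on a
  compact set and vanishes only at solutions. Without a solution, all defects would be bounded away
  from \<open>0\<close>, against the approximate fixed points.
\<close>

theorem coloured_fixed_point:
  fixes X :: "'a::euclidean_space set" and t :: "'i \<Rightarrow> 'a \<Rightarrow> real"
    and C :: "'p \<Rightarrow> 's::finite \<Rightarrow> 'a set" and g :: "'s \<Rightarrow> 'b::euclidean_space"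
    and G :: "'a \<times> 'b \<Rightarrow> 'a"
  assumes X: "compact X" "convex X" "X \<noteq> {}"
    and I: "finite I" "\<forall>i\<in>I. continuous_on X (t i)"
    and chart: "\<And>\<eta>. 0 < \<eta> \<Longrightarrow>
      \<exists>\<epsilon>>0. \<forall>x\<in>X. \<forall>y\<in>X. (\<forall>i\<in>I. \<bar>t i x - t i y\<bar> < \<epsilon>) \<longrightarrow> dist x y < \<eta>"
    and P: "finite P" "card P = card I + 1"
    and closed: "\<And>e s. e \<in> P \<Longrightarrow> closed (C e s)"
    and cover: "\<forall>e\<in>P. \<forall>x\<in>X. \<exists>s. x \<in> C e s"
    and G: "continuous_on (X \<times> (convex hull range g)) G"
      "G ` (X \<times> (convex hull range g)) \<subseteq> X"
  shows "\<exists>x\<in>X. \<exists>s. \<exists>b\<in>convex hull (g ` s ` P). G (x, b) = x \<and> (\<forall>e\<in>P. x \<in> C e (s e))"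
proof (rule ccontr)
  assume none_ex: "\<not> ?thesis"
  then have none: "\<exists>e\<in>P. x \<notin> C e (s e)"
    if "x \<in> X" "b \<in> convex hull (g ` s ` P)" "G (x, b) = x" for x s b
    using that none_ex by blast
  \<comment> \<open>Labels that are valid nowhere must be excluded, as the distance to the empty set is \<open>0\<close>.\<close>
  define S where "S = (\<Pi>\<^sub>E e\<in>P. {l. X \<inter> C e l \<noteq> {}})"
  define K where "K s = X \<times> (convex hull (g ` s ` P))" for s
  define gap where "gap s z = dist (G z) (fst z) + (\<Sum>e\<in>P. infdist (fst z) (X \<inter> C e (s e)))"
    for s z
  have card_P: "0 < card P"
    using P(2) by linarith
  have S: "finite S"
    unfolding S_def by (intro finite_PiE P) auto
  have "\<exists>\<delta>>0. \<forall>z\<in>K s. \<delta> \<le> gap s z" if s: "s \<in> S" for s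
  proof (cases "K s = {}")
    case False
    have "compact (K s)"
      unfolding K_def using P(1) by (intro compact_Times X finite_imp_compact_convex_hull) auto
    moreover have "K s \<subseteq> X \<times> (convex hull range g)"
      unfolding K_def by (intro Sigma_mono hull_mono) auto
    then have "continuous_on (K s) (gap s)"
      unfolding gap_def by (intro continuous_intros continuous_on_subset[OF G(1)])
    ultimately obtain z where z: "z \<in> K s" "\<forall>z'\<in>K s. gap s z \<le> gap s z'"
      using continuous_attains_inf False by blast
    have "gap s z \<noteq> 0"
    proof
      assume "gap s z = 0"
      moreover have dist0: "0 \<le> dist (G z) (fst z)"
        and sum0: "0 \<le> (\<Sum>e\<in>P. infdist (fst z) (X \<inter> C e (s e)))"
        by (simp_all add: sum_nonneg infdist_nonneg)
      ultimately have "dist (G z) (fst z) = 0"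
        and sum_eq0: "(\<Sum>e\<in>P. infdist (fst z) (X \<inter> C e (s e))) = 0"
        unfolding gap_def by linarith+
      then have G0: "G z = fst z" by simp
      have inf0: "\<forall>e\<in>P. infdist (fst z) (X \<inter> C e (s e)) = 0"
        using sum_eq0 by (subst (asm) sum_nonneg_eq_0_iff[OF P(1)]) (simp_all add: infdist_nonneg)
      have "fst z \<in> C e (s e)" if e: "e \<in> P" for e
      proof -
        have "closed (X \<inter> C e (s e))" "X \<inter> C e (s e) \<noteq> {}"
          using X(1) closed[OF e] s e by (auto simp: S_def compact_imp_closed closed_Int)
        then show ?thesis
          using in_closed_iff_infdist_zero inf0 e by blast
      qed
      moreover have "fst z \<in> X" "snd z \<in> convex hull (g ` s ` P)" "G (fst z, snd z) = fst z"
        using z(1) G0 by (auto simp: K_def)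
      ultimately show False using none by blast
    qed
    moreover have "0 \<le> gap s z"
      unfolding gap_def by (intro add_nonneg_nonneg sum_nonneg) (auto simp: infdist_nonneg)
    ultimately show ?thesis using z(2) by (intro exI[of _ "gap s z"]) auto
  qed (auto intro: exI[of _ 1])
  then obtain \<delta> where \<delta>: "\<And>s. s \<in> S \<Longrightarrow> 0 < \<delta> s" "\<And>s z. s \<in> S \<Longrightarrow> z \<in> K s \<Longrightarrow> \<delta> s \<le> gap s z"
    by metis
  \<comment> \<open>The defect sums one distance per player, and each is to stay below its share of the bound.\<close>
  define \<eta> where "\<eta> = Min (insert 1 (\<delta> ` S)) / card P"
  have "0 < Min (insert 1 (\<delta> ` S))"
    using S \<delta>(1) by (subst Min_gr_iff) auto
  then have "0 < \<eta>"
    using P(2) by (simp add: \<eta>_def)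
  then obtain \<epsilon> where "0 < \<epsilon>" and \<epsilon>: "\<forall>x\<in>X. \<forall>y\<in>X. (\<forall>i\<in>I. \<bar>t i x - t i y\<bar> < \<epsilon>) \<longrightarrow> dist x y < \<eta>"
    using chart by blast
  obtain x s b where x: "x \<in> X" "b \<in> convex hull (g ` s ` P)" "G (x, b) = x"
    and near: "\<forall>e\<in>P. \<exists>y\<in>X \<inter> C e (s e). \<forall>i\<in>I. \<bar>t i x - t i y\<bar> < \<epsilon>"
    using coloured_approximate_fixed_point[OF X I P cover G \<open>0 < \<epsilon>\<close>] by blast
  define s' where "s' = restrict s P"
  have "s' ` P = s ` P" unfolding s'_def by (rule image_cong) simp_all
  then have "(x, b) \<in> K s'" using x by (simp add: K_def)
  moreover have s': "s' \<in> S" using near by (auto simp: S_def s'_def)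
  moreover have "gap s' (x, b) < \<delta> s'"
  proof -
    have "infdist x (X \<inter> C e (s' e)) < \<eta>" if e: "e \<in> P" for e
    proof -
      obtain y where "y \<in> X \<inter> C e (s e)" "dist x y < \<eta>"
        using near e \<epsilon> x(1) by blast
      then show ?thesis
        using infdist_le2[of y "X \<inter> C e (s e)" x "dist x y"] e by (simp add: s'_def)
    qed
    then have "(\<Sum>e\<in>P. infdist x (X \<inter> C e (s' e))) < of_nat (card P) * \<eta>"
      using card_P by (intro sum_bounded_above_strict) auto
    then have "gap s' (x, b) < of_nat (card P) * \<eta>"
      unfolding gap_def by (simp add: x(3))
    also have "\<dots> = Min (insert 1 (\<delta> ` S))"
      using P(2) by (simp add: \<eta>_def)
    also have "\<dots> \<le> \<delta> s'" using S s' by (intro Min_le) auto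
    finally show ?thesis .
  qed
  ultimately show False using \<delta>(2) by force
qed

section \<open>From uniform demand to a perfect matching\<close>

text \<open>
  Hall's marriage theorem, with Rado's proof: as long as some \<open>A i\<close> has two elements, one of them
  can be deleted without destroying the condition, and once all sets are singletons the condition
  says that they are distinct.
\<close>

lemma hall_distinct_representatives:
  fixes A :: "'i \<Rightarrow> 'b set"
  assumes "finite I" and "\<And>i. i \<in> I \<Longrightarrow> finite (A i)"
    and "\<And>J. J \<subseteq> I \<Longrightarrow> card J \<le> card (\<Union> (A ` J))"
  shows "\<exists>f. inj_on f I \<and> (\<forall>i\<in>I. f i \<in> A i)"
  using assms(2,3)
proof (induction "\<Sum>i\<in>I. card (A i)" arbitrary: A rule: less_induct)
  case less
  note fin = less.prems(1) and hall = less.prems(2)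
  show ?case
  proof (cases "\<forall>i\<in>I. card (A i) \<le> 1")
    case True
    have "\<exists>a. A i = {a}" if "i \<in> I" for i
    proof -
      have "card (A i) = 1"
        using hall[of "{i}"] True that by (simp add: le_antisym)
      then show ?thesis by (rule card_1_singletonE) blast
    qed
    then obtain f where f: "\<And>i. i \<in> I \<Longrightarrow> A i = {f i}"
      by metis
    have "inj_on f I"
    proof (rule inj_onI, rule ccontr)
      fix i j assume ij: "i \<in> I" "j \<in> I" "f i = f j" "i \<noteq> j"
      then have "\<Union> (A ` {i, j}) = {f i}"
        using f by auto
      then show False
        using hall[of "{i, j}"] ij by auto
    qed
    then show ?thesis using f by blast
  next
    case False
    then obtain i where i: "i \<in> I" "\<not> card (A i) \<le> 1"
      by blast
    then obtain x y where xy: "x \<in> A i" "y \<in> A i" "x \<noteq> y"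
      using card_le_Suc0_iff_eq[OF fin[OF i(1)]] by auto
    define B where "B z = A(i := A i - {z})" for z
    \<comment> \<open>Submodularity of the size of a neighbourhood rules out that both deletions
      destroy the condition.\<close>
    have violated: "\<exists>J \<subseteq> I - {i}. card (A i - {z} \<union> \<Union> (A ` J)) \<le> card J"
      if bad: "\<not> (\<forall>J\<subseteq>I. card J \<le> card (\<Union> (B z ` J)))" for z
    proof -
      obtain J where J: "J \<subseteq> I" "card (\<Union> (B z ` J)) < card J"
        using bad not_le by blast
      have finJ: "finite J" using J(1) assms(1) by (rule finite_subset)
      have "i \<in> J"
      proof (rule ccontr)
        assume "i \<notin> J"
        then have "B z ` J = A ` J" by (intro image_cong) (auto simp: B_def)
        then show False using J hall[OF J(1)] by simp
      qed
      then have "\<Union> (B z ` J) = A i - {z} \<union> \<Union> (A ` (J - {i}))"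
        by (auto simp: B_def split: if_splits)
      moreover have "card J = Suc (card (J - {i}))"
        using finJ \<open>i \<in> J\<close> by (rule card.remove)
      ultimately show ?thesis
        using J by (intro exI[of _ "J - {i}"]) auto
    qed
    have "\<exists>z\<in>A i. \<forall>J\<subseteq>I. card J \<le> card (\<Union> (B z ` J))"
    proof (rule ccontr)
      assume bad: "\<not> ?thesis"
      obtain J where J: "J \<subseteq> I - {i}" "card (A i - {x} \<union> \<Union> (A ` J)) \<le> card J"
        using violated[of x] bad xy by blast
      obtain K where K: "K \<subseteq> I - {i}" "card (A i - {y} \<union> \<Union> (A ` K)) \<le> card K"
        using violated[of y] bad xy by blast
      have finJK: "finite J" "finite K"
        using J K assms(1) by (meson finite_Diff finite_subset)+
      let ?S = "A i - {x} \<union> \<Union> (A ` J)" and ?T = "A i - {y} \<union> \<Union> (A ` K)"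
      have finST: "finite ?S" "finite ?T"
        using finJK J K fin i by auto
      have "?S \<union> ?T = \<Union> (A ` insert i (J \<union> K))"
        using xy by auto
      moreover have "card (insert i (J \<union> K)) = Suc (card (J \<union> K))"
        using J K finJK by (subst card_insert_disjoint) auto
      moreover have "card (insert i (J \<union> K)) \<le> card (\<Union> (A ` insert i (J \<union> K)))"
        using J K i by (intro hall) auto
      ultimately have "Suc (card (J \<union> K)) \<le> card (?S \<union> ?T)"
        by simp
      moreover have "card (J \<inter> K) \<le> card (?S \<inter> ?T)"
      proof -
        have "card (J \<inter> K) \<le> card (\<Union> (A ` (J \<inter> K)))"
          using J K by (intro hall) auto
        also have "\<dots> \<le> card (?S \<inter> ?T)"
          using finST by (intro card_mono) auto
        finally show ?thesis .
      qed
      ultimately show False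
        using card_Un_Int[OF finST] card_Un_Int[OF finJK] J(2) K(2) by linarith
    qed
    then obtain z where z: "z \<in> A i" "\<And>J. J \<subseteq> I \<Longrightarrow> card J \<le> card (\<Union> (B z ` J))"
      by blast
    have "(\<Sum>j\<in>I. card (B z j)) < (\<Sum>j\<in>I. card (A j))"
    proof (rule sum_strict_mono_ex1[OF assms(1)])
      show "\<forall>j\<in>I. card (B z j) \<le> card (A j)"
        using fin i(1) by (auto simp: B_def intro: card_mono)
      have "card (A i - {z}) < card (A i)"
        using fin[OF i(1)] z(1) by (rule card_Diff1_less)
      then show "\<exists>j\<in>I. card (B z j) < card (A j)"
        using i(1) by (auto simp: B_def)
    qed
    moreover have "finite (B z j)" if "j \<in> I" for j
      using fin that i(1) by (simp add: B_def)
    ultimately obtain f where f: "inj_on f I" "\<forall>j\<in>I. f j \<in> B z j"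
      using less.hyps[of "B z"] z(2) by metis
    then have "\<forall>j\<in>I. f j \<in> A j"
      by (auto simp: B_def split: if_splits)
    with f(1) show ?thesis by blast
  qed
qed

definition room_pair :: "'r::finite selection \<Rightarrow> 'r division" where
  "room_pair s = (axis (fst s) 1, axis (snd s) 1)"

lemma inj_room_pair: "inj room_pair"
  by (rule injI) (auto simp: room_pair_def axis_eq_axis prod_eq_iff)

text \<open>
  The coefficients of \<open>b\<close> weight the edges \<open>E\<close> so that every room carries weight \<open>1 / n\<close>. The edges
  at a set \<open>J\<close> of rooms have total weight \<open>card J / n\<close> and all end in the neighbourhood \<open>K\<close> of \<open>J\<close>,
  where edges of total weight \<open>card K / n\<close> end. So \<open>card J \<le> card K\<close>, which is Hall's condition.
\<close>

lemma perfect_matching_of_barycentre: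
  fixes E :: "('r::finite \<times> 'r) set"
  assumes b: "b \<in> convex hull (room_pair ` E)"
    and marg: "\<And>i. fst b $ i = 1 / CARD('r)" "\<And>i. snd b $ i = 1 / CARD('r)"
  obtains f where "inj f" "\<And>i. (i, f i) \<in> E"
proof -
  obtain u where u: "\<forall>z\<in>room_pair ` E. 0 \<le> u z" "(\<Sum>z\<in>room_pair ` E. u z *\<^sub>R z) = b"
    using b by (subst (asm) convex_hull_finite) auto
  define w where "w e = u (room_pair e)" for e
  have w0: "0 \<le> w e" if "e \<in> E" for e
    using u(1) that by (simp add: w_def)
  have inj_E: "inj_on room_pair E"
    by (rule inj_on_subset[OF inj_room_pair]) simp
  have "(\<Sum>z\<in>room_pair ` E. u z *\<^sub>R z) = (\<Sum>e\<in>E. u (room_pair e) *\<^sub>R room_pair e)"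
    by (simp add: sum.reindex[OF inj_E])
  then have b_eq: "b = (\<Sum>e\<in>E. w e *\<^sub>R room_pair e)"
    using u(2) by (simp add: w_def)
  have axis: "axis k (1::real) $ i = of_bool (k = i)" for k i :: 'r
    by (simp add: axis_def)
  have b1: "fst b $ i = (\<Sum>e\<in>E. w e * of_bool (fst e = i))" for i
    unfolding b_eq by (simp add: fst_sum room_pair_def axis)
  have b2: "snd b $ i = (\<Sum>e\<in>E. w e * of_bool (snd e = i))" for i
    unfolding b_eq by (simp add: snd_sum room_pair_def axis)
  have total: "(\<Sum>e\<in>E. w e * of_bool (p e \<in> J)) = card J / CARD('r)"
    if "\<And>i. (\<Sum>e\<in>E. w e * of_bool (p e = i)) = 1 / CARD('r)" for p :: "'r \<times> 'r \<Rightarrow> 'r" and J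
  proof -
    have "(\<Sum>e\<in>E. w e * of_bool (p e \<in> J)) = (\<Sum>e\<in>E. \<Sum>i\<in>J. w e * of_bool (p e = i))"
      by (intro sum.cong) (auto simp: of_bool_def sum.delta simp flip: sum_distrib_left)
    also have "\<dots> = (\<Sum>i\<in>J. \<Sum>e\<in>E. w e * of_bool (p e = i))"
      by (rule sum.swap)
    finally show ?thesis using that by simp
  qed
  have "card J \<le> card (\<Union>i\<in>J. {k. (i, k) \<in> E})" for J
  proof -
    have "card J / CARD('r) = (\<Sum>e\<in>E. w e * of_bool (fst e \<in> J))"
      by (rule total[symmetric]) (metis b1 marg(1))
    also have "\<dots> \<le> (\<Sum>e\<in>E. w e * of_bool (snd e \<in> (\<Union>i\<in>J. {k. (i, k) \<in> E})))"
      using w0 by (intro sum_mono mult_left_mono) (auto simp: of_bool_def)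
    also have "\<dots> = card (\<Union>i\<in>J. {k. (i, k) \<in> E}) / CARD('r)"
      by (rule total) (metis b2 marg(2))
    finally show ?thesis
      by (simp add: divide_le_cancel)
  qed
  then obtain f where "inj f" "\<forall>i. f i \<in> {k. (i, k) \<in> E}"
    using hall_distinct_representatives[of UNIV "\<lambda>i. {k. (i, k) \<in> E}"] by auto
  then show thesis using that by simp
qed

section \<open>The simplex of rents\<close>

lemma convex_rent_simplex: "convex (rent_simplex :: (real ^ 'r::finite) set)"
  by (rule convexI) (auto simp: rent_simplex_def sum.distrib simp flip: sum_distrib_left)

lemma compact_rent_simplex: "compact (rent_simplex :: (real ^ 'r::finite) set)"
proof -
  have "norm y \<le> 1" if "y \<in> rent_simplex" for y :: "real ^ 'r"
    using norm_le_l1_cart[of y] that by (simp add: rent_simplex_def)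
  then have "bounded (rent_simplex :: (real ^ 'r) set)"
    by (auto simp: bounded_iff)
  moreover have "closed {y :: real ^ 'r. \<forall>i. 0 \<le> y $ i}"
    by (intro closed_Collect_all closed_Collect_le continuous_intros)
  then have "closed ({y :: real ^ 'r. \<forall>i. 0 \<le> y $ i} \<inter> {y. (\<Sum>i\<in>UNIV. y $ i) = 1})"
    by (intro closed_Int closed_Collect_eq continuous_intros)
  then have "closed (rent_simplex :: (real ^ 'r) set)"
    by (simp add: rent_simplex_def Collect_conj_eq)
  ultimately show ?thesis by (simp add: compact_eq_bounded_closed)
qed

lemma axis_in_rent_simplex: "axis i 1 \<in> rent_simplex"
  by (simp add: rent_simplex_def axis_def)

text \<open>
  One coordinate of the simplex is redundant. Dropping it in each building leaves \<open>2 n - 2\<close>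
  coordinates, one less than the number of players.
\<close>

lemma dist_rent_simplex_le:
  fixes p q :: "real ^ 'r::finite"
  assumes p: "p \<in> rent_simplex" and q: "q \<in> rent_simplex"
    and close: "\<And>i. i \<noteq> r \<Longrightarrow> \<bar>p $ i - q $ i\<bar> \<le> \<epsilon>" and "0 \<le> \<epsilon>"
  shows "dist p q \<le> real CARD('r) * (real CARD('r) * \<epsilon>)"
proof -
  have "\<bar>p $ i - q $ i\<bar> \<le> real CARD('r) * \<epsilon>" for i
  proof (cases "i = r")
    case True
    have "p $ r + (\<Sum>i\<in>UNIV - {r}. p $ i) = q $ r + (\<Sum>i\<in>UNIV - {r}. q $ i)"
      using p q sum.remove[of UNIV r "($) p"] sum.remove[of UNIV r "($) q"]
      by (simp add: rent_simplex_def)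
    then have "\<bar>p $ r - q $ r\<bar> = \<bar>\<Sum>i\<in>UNIV - {r}. p $ i - q $ i\<bar>"
      by (simp add: sum_subtractf)
    also have "\<dots> \<le> (\<Sum>i\<in>UNIV - {r}. \<bar>p $ i - q $ i\<bar>)"
      by (rule sum_abs)
    also have "\<dots> \<le> real (card (UNIV - {r})) * \<epsilon>"
      using close by (intro sum_bounded_above) auto
    also have "\<dots> \<le> real CARD('r) * \<epsilon>"
      using \<open>0 \<le> \<epsilon>\<close> by (intro mult_right_mono) (simp_all add: card_mono)
    finally show ?thesis using True by simp
  next
    case False
    have "1 * \<epsilon> \<le> real CARD('r) * \<epsilon>"
      using \<open>0 \<le> \<epsilon>\<close> by (intro mult_right_mono) (simp_all add: Suc_le_eq)
    then show ?thesis using close[OF False] by simp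
  qed
  then have "(\<Sum>i\<in>UNIV. \<bar>(p - q) $ i\<bar>) \<le> real CARD('r) * (real CARD('r) * \<epsilon>)"
    by (intro sum_bounded_above) simp
  then show ?thesis
    using norm_le_l1_cart[of "p - q"] by (simp add: dist_norm)
qed

section \<open>Price adjustment\<close>

text \<open>
  The map from the Gale--Nikaido proof of existence of equilibria: rents of overdemanded rooms rise
  by their excess demand.
\<close>

definition price_step :: "real ^ 'r::finite \<Rightarrow> real ^ 'r \<Rightarrow> real ^ 'r" where
  "price_step p q = (\<chi> i. (p $ i + max 0 (q $ i - 1 / CARD('r)))
     / (1 + (\<Sum>k\<in>UNIV. max 0 (q $ k - 1 / CARD('r)))))"

lemma price_step_denominator_pos:
  fixes q :: "real ^ 'r::finite"
  shows "0 < 1 + (\<Sum>k\<in>UNIV. max 0 (q $ k - 1 / CARD('r)))"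
  by (intro add_pos_nonneg sum_nonneg) auto

lemma price_step_in_rent_simplex:
  assumes "p \<in> rent_simplex"
  shows "price_step p q \<in> rent_simplex"
  using assms price_step_denominator_pos[of q]
  by (auto simp: rent_simplex_def price_step_def sum.distrib simp flip: sum_divide_distrib)

lemma continuous_on_price_step:
  fixes f h :: "'a::topological_space \<Rightarrow> real ^ 'r::finite"
  assumes "continuous_on S f" "continuous_on S h"
  shows "continuous_on S (\<lambda>x. price_step (f x) (h x))"
proof -
  have "1 + (\<Sum>k\<in>UNIV. max 0 (h x $ k - 1 / CARD('r))) \<noteq> 0" for x
    using price_step_denominator_pos[of "h x"] by simp
  then show ?thesis
    unfolding price_step_def by (intro continuous_intros assms ballI) auto
qed

text \<open>
  At a fixed point the rent of every room is proportional to its positive excess demand, with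
  factor \<open>D\<close>. If \<open>D\<close> were positive, a room without excess demand would be free, so by \<open>free\<close> all
  demanded rooms would be free and hence without excess demand, contradicting \<open>D > 0\<close>.
\<close>

lemma price_step_fixed_imp_barycentre:
  fixes p q :: "real ^ 'r::finite"
  assumes p: "p \<in> rent_simplex" and q: "q \<in> rent_simplex"
    and fixed: "price_step p q = p"
    and free: "\<And>i k. p $ k = 0 \<Longrightarrow> q $ i \<noteq> 0 \<Longrightarrow> p $ i = 0"
  shows "q $ i = 1 / CARD('r)"
proof -
  define z where "z i = q $ i - 1 / CARD('r)" for i
  define D where "D = (\<Sum>k\<in>UNIV. max 0 (z k))"
  have sum_z: "(\<Sum>i\<in>UNIV. z i) = 0"
    using q by (simp add: z_def sum_subtractf rent_simplex_def)
  have step: "p $ i * D = max 0 (z i)" for i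
  proof -
    have "p $ i = (p $ i + max 0 (z i)) / (1 + D)"
      using arg_cong[OF fixed, of "\<lambda>v. v $ i"] by (simp add: price_step_def D_def z_def)
    moreover have "0 < 1 + D"
      unfolding D_def z_def by (rule price_step_denominator_pos)
    ultimately show ?thesis by (simp add: field_simps)
  qed
  have nonpos: "z i \<le> 0" for i
  proof (rule ccontr)
    assume i: "\<not> z i \<le> 0"
    have "D \<noteq> 0"
      using step[of i] i by auto
    have "\<exists>k. z k \<le> 0"
    proof (rule ccontr)
      assume "\<nexists>k. z k \<le> 0"
      then have "0 < (\<Sum>k\<in>UNIV. z k)"
        by (intro sum_pos) (simp_all add: not_le)
      then show False using sum_z by simp
    qed
    then obtain k where "z k \<le> 0" by blast
    then have "p $ k = 0"
      using step[of k] \<open>D \<noteq> 0\<close> by simp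
    moreover have "q $ i \<noteq> 0"
      using i by (auto simp: z_def)
    ultimately have "p $ i = 0"
      by (rule free)
    then show False
      using step[of i] i by simp
  qed
  have "z i = 0"
    using sum_nonneg_eq_0_iff[of UNIV "\<lambda>i. - z i"] nonpos sum_z by (simp add: sum_negf)
  then show ?thesis by (simp add: z_def)
qed

section \<open>Sharing two buildings\<close>

lemma convex_hull_room_pair_subset: "convex hull range room_pair \<subseteq> divisions"
proof (rule hull_minimal)
  show "range room_pair \<subseteq> divisions"
    by (auto simp: room_pair_def divisions_def axis_in_rent_simplex)
  show "convex (divisions :: 'a division set)"
    unfolding divisions_def by (intro convex_Times convex_rent_simplex)
qed

lemma hull_room_pair_coordinate_zero:
  fixes E :: "('r::finite \<times> 'r) set"
  assumes b: "b \<in> convex hull (room_pair ` E)"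
  shows "(\<And>e. e \<in> E \<Longrightarrow> fst e \<noteq> i) \<Longrightarrow> fst b $ i = 0"
    and "(\<And>e. e \<in> E \<Longrightarrow> snd e \<noteq> i) \<Longrightarrow> snd b $ i = 0"
proof -
  have convex: "convex {z :: 'r division. fst z $ i = 0}" "convex {z :: 'r division. snd z $ i = 0}"
    by (auto simp: convex_def)
  show "fst b $ i = 0" if "\<And>e. e \<in> E \<Longrightarrow> fst e \<noteq> i"
  proof -
    have "convex hull (room_pair ` E) \<subseteq> {z. fst z $ i = 0}"
    proof (rule hull_minimal)
      show "room_pair ` E \<subseteq> {z. fst z $ i = 0}"
        using that by (fastforce simp: room_pair_def axis_def)
    qed (rule convex(1))
    then show ?thesis using b by blast
  qed
  show "snd b $ i = 0" if "\<And>e. e \<in> E \<Longrightarrow> snd e \<noteq> i"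
  proof -
    have "convex hull (room_pair ` E) \<subseteq> {z. snd z $ i = 0}"
    proof (rule hull_minimal)
      show "room_pair ` E \<subseteq> {z. snd z $ i = 0}"
        using that by (fastforce simp: room_pair_def axis_def)
    qed (rule convex(2))
    then show ?thesis using b by blast
  qed
qed

theorem corollary1p5:
  fixes P :: "'p set"
    and C :: "'p \<Rightarrow> 'r::finite preferences"
  assumes "finite P" and "card P = 2 * CARD('r) - 1"
    and "\<And>e s. e \<in> P \<Longrightarrow> C e s \<subseteq> divisions"
    and "\<And>e. e \<in> P \<Longrightarrow> prefers_free_rooms (C e)"
    and "\<And>e. e \<in> P \<Longrightarrow> indifferent_between_free_rooms (C e)"
    and "\<And>e. e \<in> P \<Longrightarrow> closed_preferences (C e)"
    and "\<And>e. e \<in> P \<Longrightarrow> always_finds_acceptable (C e)"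
  shows "\<exists>x \<in> divisions. \<exists>N s. N \<subseteq> P \<and> card N = CARD('r) \<and>
           (\<forall>e \<in> N. x \<in> C e (s e)) \<and>
           (\<forall>e \<in> N. \<forall>e' \<in> N. e \<noteq> e' \<longrightarrow>
              fst (s e) \<noteq> fst (s e') \<and> snd (s e) \<noteq> snd (s e'))"
proof -
  have X: "compact (divisions :: 'r division set)" "convex (divisions :: 'r division set)"
    "(divisions :: 'r division set) \<noteq> {}"
    using axis_in_rent_simplex
    by (auto simp: divisions_def intro: compact_Times compact_rent_simplex convex_Times
        convex_rent_simplex)
  obtain r :: 'r where "r \<in> UNIV" by blast
  define I where "I = (UNIV :: bool set) \<times> (UNIV - {r})"
  define t where "t i x = (if fst i then fst x else snd x) $ snd i"
    for i :: "bool \<times> 'r" and x :: "'r division"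
  have card_I: "card P = card I + 1"
  proof -
    have "card I = 2 * (CARD('r) - 1)"
      unfolding I_def card_cartesian_product by (simp add: card_Diff_singleton)
    moreover have "1 \<le> CARD('r)"
      by (simp add: Suc_le_eq)
    ultimately show ?thesis using assms(2) by linarith
  qed
  have chart: "\<exists>\<epsilon>>0. \<forall>x\<in>divisions. \<forall>y\<in>divisions.
      (\<forall>i\<in>I. \<bar>t i x - t i y\<bar> < \<epsilon>) \<longrightarrow> dist x y < \<eta>" if "0 < \<eta>" for \<eta>
  proof -
    define n where "n = real CARD('r)"
    \<comment> \<open>Each building contributes a distance of at most \<open>n * (n * \<epsilon>)\<close>; the factor \<open>3\<close> makes the
      sum of two of these strictly smaller than \<open>\<eta>\<close>.\<close>
    define \<epsilon> where "\<epsilon> = \<eta> / (3 * n * n)"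
    have n: "0 < n" by (simp add: n_def)
    then have \<epsilon>: "0 < \<epsilon>" "n * (n * \<epsilon>) = \<eta> / 3"
      using that by (simp_all add: \<epsilon>_def field_simps)
    have "dist x y < \<eta>"
      if x: "x \<in> divisions" and y: "y \<in> divisions" and close: "\<forall>i\<in>I. \<bar>t i x - t i y\<bar> < \<epsilon>"
      for x y :: "'r division"
    proof -
      have "\<bar>fst x $ i - fst y $ i\<bar> \<le> \<epsilon>" "\<bar>snd x $ i - snd y $ i\<bar> \<le> \<epsilon>" if "i \<noteq> r" for i
        using bspec[OF close, of "(True, i)"] bspec[OF close, of "(False, i)"] that
        by (simp_all add: I_def t_def)
      moreover have "fst x \<in> rent_simplex" "fst y \<in> rent_simplex"
        "snd x \<in> rent_simplex" "snd y \<in> rent_simplex"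
        using x y by (auto simp: divisions_def)
      ultimately have "dist (fst x) (fst y) \<le> n * (n * \<epsilon>)" "dist (snd x) (snd y) \<le> n * (n * \<epsilon>)"
        unfolding n_def using \<epsilon>(1) by (auto intro!: dist_rent_simplex_le[where r = r])
      moreover have "dist x y \<le> dist (fst x) (fst y) + dist (snd x) (snd y)"
        unfolding dist_prod_def by (rule sqrt_sum_squares_le_sum) simp_all
      ultimately show ?thesis
        using \<epsilon>(2) \<open>0 < \<eta>\<close> by linarith
    qed
    then show ?thesis using \<epsilon>(1) by blast
  qed
  define G where "G z = (price_step (fst (fst z)) (fst (snd z)), price_step (snd (fst z)) (snd (snd z)))"
    for z :: "'r division \<times> 'r division"
  have "\<exists>x\<in>divisions. \<exists>s. \<exists>b\<in>convex hull (room_pair ` s ` P).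
      G (x, b) = x \<and> (\<forall>e\<in>P. x \<in> C e (s e))"
  proof (rule coloured_fixed_point[OF X])
    show "finite I" by (simp add: I_def)
    have "continuous_on divisions (t i)" for i
      unfolding t_def by (cases "fst i") (simp_all add: continuous_intros)
    then show "\<forall>i\<in>I. continuous_on divisions (t i)" by blast
    show "finite P" "card P = card I + 1" by (fact assms(1) card_I)+
    show "closed (C e s)" if "e \<in> P" for e s
      using assms(6)[OF that] unfolding closed_preferences_def by blast
    show "\<forall>e\<in>P. \<forall>x\<in>divisions. \<exists>s. x \<in> C e s"
      using assms(7) unfolding always_finds_acceptable_def by blast
    show "continuous_on (divisions \<times> (convex hull range room_pair)) G"
      unfolding G_def by (intro continuous_on_Pair continuous_on_price_step continuous_intros)
    show "G ` (divisions \<times> (convex hull range room_pair)) \<subseteq> divisions"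
      by (auto simp: G_def divisions_def intro: price_step_in_rent_simplex)
  qed (rule chart)
  then obtain x s b where x: "x \<in> divisions" and b: "b \<in> convex hull (room_pair ` s ` P)"
    and G: "G (x, b) = x" and acceptable: "\<And>e. e \<in> P \<Longrightarrow> x \<in> C e (s e)"
    by blast
  have simplex: "fst x \<in> rent_simplex" "snd x \<in> rent_simplex"
    using x by (auto simp: divisions_def)
  have "convex hull (room_pair ` s ` P) \<subseteq> divisions"
    using convex_hull_room_pair_subset hull_mono[of "room_pair ` s ` P" "range room_pair" convex]
    by blast
  then have b_simplex: "fst b \<in> rent_simplex" "snd b \<in> rent_simplex"
    using b by (auto simp: divisions_def)
  have prices: "price_step (fst x) (fst b) = fst x" "price_step (snd x) (snd b) = snd x"
    using G by (simp_all add: G_def prod_eq_iff)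
  \<comment> \<open>All selections are acceptable at \<open>x\<close> itself, so the preference for free rooms applies to them.\<close>
  have free: "fst x $ fst (s e) = 0 \<or> (\<forall>k. fst x $ k \<noteq> 0)"
    "snd x $ snd (s e) = 0 \<or> (\<forall>k. snd x $ k \<noteq> 0)" if "e \<in> P" for e
    using assms(4)[OF that] acceptable[OF that]
    unfolding prefers_free_rooms_def is_free_def by blast+
  have "fst b $ i = 1 / CARD('r)" for i
  proof (rule price_step_fixed_imp_barycentre[OF simplex(1) b_simplex(1) prices(1)])
    fix i k assume "fst x $ k = 0" "fst b $ i \<noteq> 0"
    then obtain e where "e \<in> P" "fst (s e) = i"
      using hull_room_pair_coordinate_zero(1)[OF b, of i] by blast
    then show "fst x $ i = 0"
      using free(1) \<open>fst x $ k = 0\<close> by blast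
  qed
  moreover have "snd b $ i = 1 / CARD('r)" for i
  proof (rule price_step_fixed_imp_barycentre[OF simplex(2) b_simplex(2) prices(2)])
    fix i k assume "snd x $ k = 0" "snd b $ i \<noteq> 0"
    then obtain e where "e \<in> P" "snd (s e) = i"
      using hull_room_pair_coordinate_zero(2)[OF b, of i] by blast
    then show "snd x $ i = 0"
      using free(2) \<open>snd x $ k = 0\<close> by blast
  qed
  ultimately obtain f where f: "inj f" "\<And>i. (i, f i) \<in> s ` P"
    using perfect_matching_of_barycentre[OF b] by blast
  then have "\<exists>e. e \<in> P \<and> s e = (i, f i)" for i
    by (metis imageE)
  then obtain tenant where tenant: "\<And>i. tenant i \<in> P" "\<And>i. s (tenant i) = (i, f i)"
    by metis
  have "inj tenant"
    by (rule injI) (metis tenant(2) prod.inject)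
  then have "card (range tenant) = CARD('r)"
    by (rule card_image)
  moreover have "fst (s e) \<noteq> fst (s e') \<and> snd (s e) \<noteq> snd (s e')"
    if "e \<in> range tenant" "e' \<in> range tenant" "e \<noteq> e'" for e e'
    using that tenant(2) f(1) by (auto simp: inj_eq)
  moreover have "range tenant \<subseteq> P" "\<forall>e\<in>range tenant. x \<in> C e (s e)"
    using tenant(1) acceptable by auto
  ultimately show ?thesis
    using x by blast
qed

end
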